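(* Let $\boldsymbol{\Gamma}$ be a pointclass and $E$ an equivalence relation on a Polish space $X$. If $(\boldsymbol{\Gamma},E)$-determinacy holds, then $(\boldsymbol{\Gamma},E,T)$-determinacy holds for every pruned tree $T\subseteq\omega^{<\omega}$.
   Context: A pointclass is a collection of subsets of Polish spaces closed under continuous preimages. $(\boldsymbol{\Gamma},E)$-determinacy means: for every continuous surjection $\pi:\omega^\omega\to X$ and every $E$-invariant set $A\subseteq X$ in $\boldsymbol{\Gamma}$, the set $\pi^{-1}(A)\subseteq\omega^\omega$ is determined (Gale–Stewart game where players alternately play natural numbers). A tree $T\subseteq\omega^{<\omega}$ is pruned if it has no terminal nodes; $[T]$ is its set of infinite branches. $(\boldsymbol{\Gamma},E,T)$-determinacy means: for every continuous surjection $\pi:[T]\to X$ and every $E$-invariant set $A\subseteq X$ in $\boldsymbol{\Gamma}$, the game $G(\pi^{-1}(A),T)$ is determined, where in $G(\pi^{-1}(A),T)$ the players alternately play natural numbers, must keep the position in $T$ (the first player to make a move leaving $T$ loses), and if both always stay in $T$, player I wins iff the resulting branch lies in $\pi^{-1}(A)$. *)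

theory Defs
  imports "HOL-Analysis.Analysis" "HOL-Library.Sublist"
begin

definition polish_topology :: "'a topology \<Rightarrow> bool" where
  "polish_topology X \<longleftrightarrow> separable_space X \<and> completely_metrizable_space X"

text \<open>
  A pointclass is a collection of pairs \<open>(X, A)\<close>, read "\<open>A\<close> is a subset of the Polish space \<open>X\<close>
  belonging to the pointclass". The spaces range over all Polish topologies whose points lie in
  the type \<open>'a\<close>, with arbitrary carrier \<open>topspace X\<close>. As \<open>'a\<close> is arbitrary, it may be any type
  having at least continuum many elements, and then every Polish space has a homeomorphic copy
  among these.
\<close>
definition pointclass :: "('a topology \<times> 'a set) set \<Rightarrow> bool" where
  "pointclass \<Gamma> \<longleftrightarrow>
     (\<forall>(X, A) \<in> \<Gamma>. polish_topology X \<and> A \<subseteq> topspace X) \<and>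
     (\<forall>X Y f A. polish_topology X \<longrightarrow> (Y, A) \<in> \<Gamma> \<longrightarrow> continuous_map X Y f \<longrightarrow>
        (X, {x \<in> topspace X. f x \<in> A}) \<in> \<Gamma>)"

definition invariant_set :: "('a \<times> 'a) set \<Rightarrow> 'a set \<Rightarrow> bool" where
  "invariant_set E A \<longleftrightarrow> (\<forall>(x, y) \<in> E. x \<in> A \<longrightarrow> y \<in> A)"

definition baire_space :: "(nat \<Rightarrow> nat) topology" where
  "baire_space = product_topology (\<lambda>_. discrete_topology UNIV) UNIV"

definition initial_segment :: "(nat \<Rightarrow> nat) \<Rightarrow> nat \<Rightarrow> nat list" where
  "initial_segment x n = map x [0..<n]"

text \<open>
  Player I makes the moves \<open>x 0, x 2, \<dots>\<close> and player II the moves \<open>x 1, x 3, \<dots>\<close>. A strategy is a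
  function on all positions; only its values at positions where its owner is to move matter.
\<close>
definition follows_I :: "(nat list \<Rightarrow> nat) \<Rightarrow> (nat \<Rightarrow> nat) \<Rightarrow> bool" where
  "follows_I \<sigma> x \<longleftrightarrow> (\<forall>n. even n \<longrightarrow> x n = \<sigma> (initial_segment x n))"

definition follows_II :: "(nat list \<Rightarrow> nat) \<Rightarrow> (nat \<Rightarrow> nat) \<Rightarrow> bool" where
  "follows_II \<tau> x \<longleftrightarrow> (\<forall>n. odd n \<longrightarrow> x n = \<tau> (initial_segment x n))"

text \<open>The argument \<open>W\<close> is the set of plays won by player I.\<close>
definition determined :: "(nat \<Rightarrow> nat) set \<Rightarrow> bool" where
  "determined W \<longleftrightarrow>
     (\<exists>\<sigma>. \<forall>x. follows_I \<sigma> x \<longrightarrow> x \<in> W) \<or> (\<exists>\<tau>. \<forall>x. follows_II \<tau> x \<longrightarrow> x \<notin> W)"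

definition is_tree :: "nat list set \<Rightarrow> bool" where
  "is_tree T \<longleftrightarrow> (\<forall>t \<in> T. \<forall>s. prefix s t \<longrightarrow> s \<in> T)"

definition pruned_tree :: "nat list set \<Rightarrow> bool" where
  "pruned_tree T \<longleftrightarrow> is_tree T \<and> (\<forall>s \<in> T. \<exists>t \<in> T. strict_prefix s t)"

definition branches :: "nat list set \<Rightarrow> (nat \<Rightarrow> nat) set" where
  "branches T = {x. \<forall>n. initial_segment x n \<in> T}"

text \<open>
  The plays won by player I in \<open>G(B, T)\<close>. The move with index \<open>n\<close> leads to the position
  \<open>initial_segment x (Suc n)\<close>, so the \<open>LEAST\<close> term is the index of the first move leaving \<open>T\<close>; that
  move is made by player II iff its index is odd.
\<close>
definition tree_game :: "(nat \<Rightarrow> nat) set \<Rightarrow> nat list set \<Rightarrow> (nat \<Rightarrow> nat) set" where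
  "tree_game B T =
     {x. if x \<in> branches T then x \<in> B else odd (LEAST n. initial_segment x (Suc n) \<notin> T)}"

definition determinacy ::
  "('a topology \<times> 'a set) set \<Rightarrow> 'a topology \<Rightarrow> ('a \<times> 'a) set \<Rightarrow> bool" where
  "determinacy \<Gamma> X E \<longleftrightarrow>
     (\<forall>\<pi> A. continuous_map baire_space X \<pi> \<and> \<pi> ` topspace baire_space = topspace X \<and>
        (X, A) \<in> \<Gamma> \<and> invariant_set E A \<longrightarrow>
        determined {x \<in> topspace baire_space. \<pi> x \<in> A})"

definition tree_determinacy ::
  "('a topology \<times> 'a set) set \<Rightarrow> 'a topology \<Rightarrow> ('a \<times> 'a) set \<Rightarrow> nat list set \<Rightarrow> bool" where
  "tree_determinacy \<Gamma> X E T \<longleftrightarrow>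
     (\<forall>\<pi> A. continuous_map (subtopology baire_space (branches T)) X \<pi> \<and>
        \<pi> ` branches T = topspace X \<and> (X, A) \<in> \<Gamma> \<and> invariant_set E A \<longrightarrow>
        determined (tree_game {x \<in> branches T. \<pi> x \<in> A} T))"

end

theory Submission
  imports Defs
begin

text \<open>
  Replacing every illegal move of a play by the least legal one defines a continuous retraction
  \<open>r\<close> of Baire space onto \<open>[T]\<close>, so \<open>\<pi> \<circ> r\<close> is a continuous surjection from Baire space and the
  game with payoff \<open>(\<pi> \<circ> r)\<^sup>-\<^sup>1(A)\<close> is determined. A winning strategy in that game is transferred to
  the game on \<open>T\<close>: its owner keeps an auxiliary play that contains the uncorrected answers of the
  given strategy and the actual moves of the opponent, and plays the corrected answers on \<open>T\<close>.
  As long as the opponent stays in \<open>T\<close>, the auxiliary play is mapped by \<open>r\<close> to the actual one.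
\<close>

section \<open>Initial segments and maps on Baire space\<close>

lemma initial_segment_0 [simp]: "initial_segment x 0 = []"
  by (simp add: initial_segment_def)

lemma initial_segment_Suc: "initial_segment x (Suc n) = initial_segment x n @ [x n]"
  by (simp add: initial_segment_def)

lemma length_initial_segment [simp]: "length (initial_segment x n) = n"
  by (simp add: initial_segment_def)

lemma nth_initial_segment: "i < n \<Longrightarrow> initial_segment x n ! i = x i"
  by (simp add: initial_segment_def)

lemma topspace_baire_space [simp]: "topspace baire_space = UNIV"
  by (simp add: baire_space_def)

text \<open>Fixing the first \<open>n\<close> coordinates of \<open>x\<close> cuts out a basic open
  neighbourhood on which \<open>f\<close> is constant, so preimages of arbitrary sets are open. It
  is applied to the coordinates of the retraction.\<close>

lemma continuous_map_baire_space_discrete: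
  assumes "\<And>x y. (\<And>i. i < n \<Longrightarrow> x i = y i) \<Longrightarrow> f x = f y"
  shows "continuous_map baire_space (discrete_topology UNIV) f"
proof -
  have "openin baire_space {x. f x \<in> U}" for U
  proof (subst openin_subopen, intro ballI)
    fix x assume x: "x \<in> {x. f x \<in> U}"
    define N where "N = (\<Pi>\<^sub>E i\<in>UNIV. if i < n then {x i} else (UNIV :: nat set))"
    have "finite {i. (if i < n then {x i} else (UNIV :: nat set)) \<noteq> UNIV}"
      by (rule finite_subset[of _ "{..<n}"]) auto
    then have "openin baire_space N"
      unfolding baire_space_def N_def by (intro product_topology_basis) auto
    moreover have "x \<in> N"
      by (auto simp: N_def)
    moreover have "N \<subseteq> {x. f x \<in> U}"
    proof
      fix y assume "y \<in> N"
      then have "y i = x i" if "i < n" for i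
        using that by (auto simp: N_def PiE_iff split: if_splits)
      then have "f y = f x"
        by (rule assms)
      then show "y \<in> {x. f x \<in> U}"
        using x by simp
    qed
    ultimately show "\<exists>N. openin baire_space N \<and> x \<in> N \<and> N \<subseteq> {x. f x \<in> U}"
      by blast
  qed
  then show ?thesis
    by (auto simp: continuous_map_def)
qed

section \<open>The retraction of Baire space onto the branches\<close>

definition correct_move :: "nat list set \<Rightarrow> nat list \<Rightarrow> nat \<Rightarrow> nat" where
  "correct_move T s a = (if s @ [a] \<in> T then a else (LEAST b. s @ [b] \<in> T))"

text \<open>Legality of a move is judged at the position already corrected, not at the original one,
  so the recursion has to carry the whole position.\<close>

fun corrected_position :: "nat list set \<Rightarrow> (nat \<Rightarrow> nat) \<Rightarrow> nat \<Rightarrow> nat list" where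
  "corrected_position T x 0 = []"
| "corrected_position T x (Suc n) =
     corrected_position T x n @ [correct_move T (corrected_position T x n) (x n)]"

definition retraction :: "nat list set \<Rightarrow> (nat \<Rightarrow> nat) \<Rightarrow> nat \<Rightarrow> nat" where
  "retraction T x n = correct_move T (corrected_position T x n) (x n)"

lemma correct_move_in_tree:
  assumes "pruned_tree T" "s \<in> T"
  shows "s @ [correct_move T s a] \<in> T"
proof -
  obtain t where t: "t \<in> T" "strict_prefix s t"
    using assms by (auto simp: pruned_tree_def)
  \<comment> \<open>The proper extension may be longer by several entries; by prefix closure its
    first new entry \<open>b\<close> is a legal move, so the \<open>LEAST\<close> in
    \<open>correct_move\<close> is attained.\<close>
  then obtain b u where "t = s @ b # u"
    by (auto elim: strict_prefixE')
  then have "prefix (s @ [b]) t"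
    by (simp add: prefix_def)
  then have "s @ [b] \<in> T"
    using t assms(1) by (auto simp: pruned_tree_def is_tree_def)
  then show ?thesis
    by (auto simp: correct_move_def intro: LeastI)
qed

lemma initial_segment_retraction: "initial_segment (retraction T x) n = corrected_position T x n"
  by (induction n) (simp_all add: initial_segment_Suc retraction_def)

lemma corrected_position_cong:
  "(\<And>i. i < n \<Longrightarrow> x i = y i) \<Longrightarrow> corrected_position T x n = corrected_position T y n"
  by (induction n) auto

lemma retraction_in_branches:
  assumes "pruned_tree T" "[] \<in> T"
  shows "retraction T x \<in> branches T"
proof -
  have "corrected_position T x n \<in> T" for n
    by (induction n) (auto simp: assms correct_move_in_tree)
  then show ?thesis
    by (simp add: branches_def initial_segment_retraction)
qed

text \<open>This replaces the recursion by a check at the positions of the expected value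
  \<open>y\<close>. It serves both for fixed points of the retraction and for the auxiliary play
  built from a strategy.\<close>

lemma retraction_eqI:
  assumes "\<And>n. correct_move T (initial_segment y n) (x n) = y n"
  shows "retraction T x = y"
proof
  have "corrected_position T x n = initial_segment y n" for n
    by (induction n) (simp_all add: assms initial_segment_Suc)
  then show "retraction T x n = y n" for n
    by (simp add: retraction_def assms)
qed

lemma correct_move_branch:
  assumes "x \<in> branches T"
  shows "correct_move T (initial_segment x n) (x n) = x n"
proof -
  have "initial_segment x n @ [x n] \<in> T"
    using assms by (auto simp: branches_def simp flip: initial_segment_Suc)
  then show ?thesis
    by (simp add: correct_move_def)
qed

lemma retraction_branch: "x \<in> branches T \<Longrightarrow> retraction T x = x"
  by (intro retraction_eqI correct_move_branch)

lemma continuous_map_retraction: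
  assumes "pruned_tree T" "[] \<in> T"
  shows "continuous_map baire_space (subtopology baire_space (branches T)) (retraction T)"
proof -
  have "continuous_map baire_space (discrete_topology UNIV) (\<lambda>x. retraction T x n)" for n
  proof (rule continuous_map_baire_space_discrete[of "Suc n"])
    fix x y :: "nat \<Rightarrow> nat" assume eq: "\<And>i. i < Suc n \<Longrightarrow> x i = y i"
    then have "corrected_position T x n = corrected_position T y n"
      by (intro corrected_position_cong) simp
    then show "retraction T x n = retraction T y n"
      by (simp add: retraction_def eq)
  qed
  then have "continuous_map baire_space baire_space (retraction T)"
    \<comment> \<open>Only the codomain is unfolded, so that continuity can be checked
      coordinatewise.\<close>
    by (subst (2) baire_space_def) (simp add: continuous_map_componentwise_UNIV)
  then show ?thesis
    by (simp add: continuous_map_in_subtopology image_subset_iff retraction_in_branches assms)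
qed

section \<open>Transfer of strategies to the tree\<close>

fun auxiliary_position ::
  "(nat \<Rightarrow> bool) \<Rightarrow> (nat list \<Rightarrow> nat) \<Rightarrow> (nat \<Rightarrow> nat) \<Rightarrow> nat \<Rightarrow> nat list" where
  "auxiliary_position P \<sigma> x 0 = []"
| "auxiliary_position P \<sigma> x (Suc n) =
     auxiliary_position P \<sigma> x n @ [if P n then \<sigma> (auxiliary_position P \<sigma> x n) else x n]"

text \<open>This locality allows a strategy, which sees only a finite position, to compute the
  auxiliary position.\<close>

lemma auxiliary_position_cong:
  "(\<And>i. i < n \<Longrightarrow> x i = y i) \<Longrightarrow> auxiliary_position P \<sigma> x n = auxiliary_position P \<sigma> y n"
  by (induction n) auto

text \<open>The predicate \<open>P\<close> holds of the indices of the moves made by the owner of the strategy.\<close>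

lemma strategy_transfer:
  assumes "pruned_tree T"
  obtains \<sigma>' where
    "\<And>x n. \<lbrakk>\<And>n. P n \<Longrightarrow> x n = \<sigma>' (initial_segment x n); P n; initial_segment x n \<in> T\<rbrakk>
       \<Longrightarrow> initial_segment x (Suc n) \<in> T"
    "\<And>x. \<lbrakk>\<And>n. P n \<Longrightarrow> x n = \<sigma>' (initial_segment x n); x \<in> branches T\<rbrakk>
       \<Longrightarrow> \<exists>z. retraction T z = x \<and> (\<forall>n. P n \<longrightarrow> z n = \<sigma> (initial_segment z n))"
proof -
  let ?aux = "auxiliary_position P \<sigma>"
  \<comment> \<open>\<open>nth s\<close> turns the position into a sequence; its values from
    \<open>length s\<close> on are irrelevant, since only earlier entries are read.\<close>
  define \<sigma>' where "\<sigma>' s = correct_move T s (\<sigma> (?aux (nth s) (length s)))" for s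
  have \<sigma>': "\<sigma>' (initial_segment x n) = correct_move T (initial_segment x n) (\<sigma> (?aux x n))" for x n
  proof -
    have "?aux (nth (initial_segment x n)) n = ?aux x n"
      by (intro auxiliary_position_cong) (simp add: nth_initial_segment)
    then show ?thesis
      by (simp add: \<sigma>'_def)
  qed
  show thesis
  proof (rule that[of \<sigma>'])
    fix x n
    assume "\<And>n. P n \<Longrightarrow> x n = \<sigma>' (initial_segment x n)" "P n" "initial_segment x n \<in> T"
    then show "initial_segment x (Suc n) \<in> T"
      using correct_move_in_tree[OF assms] by (simp add: initial_segment_Suc \<sigma>')
  next
    fix x
    assume x: "\<And>n. P n \<Longrightarrow> x n = \<sigma>' (initial_segment x n)" "x \<in> branches T"
    \<comment> \<open>The auxiliary play in full: uncorrected answers of \<open>\<sigma>\<close> at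
      the owner's turns, the actual moves of \<open>x\<close> at the opponent's.\<close>
    define z where "z n = (if P n then \<sigma> (?aux x n) else x n)" for n
    have z: "initial_segment z n = ?aux x n" for n
      by (induction n) (simp_all add: initial_segment_Suc z_def)
    have "retraction T z = x"
    proof (rule retraction_eqI)
      fix n
      show "correct_move T (initial_segment x n) (z n) = x n"
      proof (cases "P n")
        case True
        then show ?thesis
          using x(1)[OF True] by (simp add: z_def \<sigma>')
      next
        case False
        \<comment> \<open>The opponent's moves stay in \<open>T\<close> because \<open>x\<close> is
          a branch, so correction leaves them unchanged.\<close>
        then show ?thesis
          by (simp add: z_def correct_move_branch x(2))
      qed
    qed
    moreover have "\<forall>n. P n \<longrightarrow> z n = \<sigma> (initial_segment z n)"
      unfolding z by (simp add: z_def)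
    ultimately show "\<exists>z. retraction T z = x \<and> (\<forall>n. P n \<longrightarrow> z n = \<sigma> (initial_segment z n))"
      by blast
  qed
qed

section \<open>Determinacy of the game on the tree\<close>

lemma first_move_leaving_tree:
  assumes "[] \<in> T" "x \<notin> branches T"
  defines "n \<equiv> LEAST n. initial_segment x (Suc n) \<notin> T"
  shows "initial_segment x n \<in> T" "initial_segment x (Suc n) \<notin> T"
proof -
  obtain m where m: "initial_segment x m \<notin> T"
    using assms(2) by (auto simp: branches_def)
  \<comment> \<open>Since the root lies in \<open>T\<close>, the shift by one in the
    \<open>LEAST\<close> term misses no exit from the tree.\<close>
  with assms(1) obtain k where "m = Suc k"
    by (cases m) auto
  with m have "initial_segment x (Suc k) \<notin> T"
    by simp
  then show "initial_segment x (Suc n) \<notin> T"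
    unfolding n_def by (rule LeastI)
  show "initial_segment x n \<in> T"
  proof (cases n)
    case 0
    then show ?thesis using assms(1) by simp
  next
    case (Suc j)
    then have "j < (LEAST n. initial_segment x (Suc n) \<notin> T)"
      by (simp add: n_def)
    then have "initial_segment x (Suc j) \<in> T"
      using not_less_Least by blast
    with Suc show ?thesis by simp
  qed
qed

text \<open>The very first move, of even index 0, leaves the empty tree, so player I loses every
  play.\<close>

lemma determined_tree_game_empty: "determined (tree_game B {})"
proof -
  have "x \<notin> tree_game B {}" for x
    by (auto simp: tree_game_def branches_def)
  then show ?thesis
    by (auto simp: determined_def)
qed

text \<open>The same transfer is used with \<open>P\<close> as \<open>even\<close> for player I and
  as \<open>odd\<close> for player II. In each case \<open>legal\<close> settles the plays that
  leave \<open>T\<close>, and \<open>lift\<close> settles the branches through a play following the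
  original strategy.\<close>

lemma determined_tree_game:
  assumes T: "pruned_tree T" "[] \<in> T" and W: "determined {x. retraction T x \<in> B}"
  shows "determined (tree_game B T)"
  using W unfolding determined_def
proof (elim disjE exE)
  fix \<sigma> assume \<sigma>: "\<forall>x. follows_I \<sigma> x \<longrightarrow> x \<in> {x. retraction T x \<in> B}"
  obtain \<sigma>' where legal:
      "\<And>x n. \<lbrakk>\<And>n. even n \<Longrightarrow> x n = \<sigma>' (initial_segment x n); even n; initial_segment x n \<in> T\<rbrakk>
        \<Longrightarrow> initial_segment x (Suc n) \<in> T"
    and lift: "\<And>x. \<lbrakk>\<And>n. even n \<Longrightarrow> x n = \<sigma>' (initial_segment x n); x \<in> branches T\<rbrakk>
        \<Longrightarrow> \<exists>z. retraction T z = x \<and> (\<forall>n. even n \<longrightarrow> z n = \<sigma> (initial_segment z n))"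
    by (rule strategy_transfer[OF T(1), where P = even and \<sigma> = \<sigma>]) blast
  have "x \<in> tree_game B T" if "follows_I \<sigma>' x" for x
  proof (cases "x \<in> branches T")
    case True
    then obtain z where "retraction T z = x" "follows_I \<sigma> z"
      using lift[of x] \<open>follows_I \<sigma>' x\<close> unfolding follows_I_def by blast
    then show ?thesis
      using \<sigma> True by (auto simp: tree_game_def)
  next
    case False
    \<comment> \<open>An even index for the first illegal move would contradict \<open>legal\<close>
      at the last position in \<open>T\<close>; so it is odd and player I wins.\<close>
    then show ?thesis
      using legal[of x] first_move_leaving_tree[OF T(2) False] \<open>follows_I \<sigma>' x\<close>
      unfolding follows_I_def tree_game_def by auto
  qed
  then show "(\<exists>\<sigma>. \<forall>x. follows_I \<sigma> x \<longrightarrow> x \<in> tree_game B T) \<or>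
    (\<exists>\<tau>. \<forall>x. follows_II \<tau> x \<longrightarrow> x \<notin> tree_game B T)"
    by blast
next
  fix \<tau> assume \<tau>: "\<forall>x. follows_II \<tau> x \<longrightarrow> x \<notin> {x. retraction T x \<in> B}"
  obtain \<tau>' where legal:
      "\<And>x n. \<lbrakk>\<And>n. odd n \<Longrightarrow> x n = \<tau>' (initial_segment x n); odd n; initial_segment x n \<in> T\<rbrakk>
        \<Longrightarrow> initial_segment x (Suc n) \<in> T"
    and lift: "\<And>x. \<lbrakk>\<And>n. odd n \<Longrightarrow> x n = \<tau>' (initial_segment x n); x \<in> branches T\<rbrakk>
        \<Longrightarrow> \<exists>z. retraction T z = x \<and> (\<forall>n. odd n \<longrightarrow> z n = \<tau> (initial_segment z n))"
    by (rule strategy_transfer[OF T(1), where P = odd and \<sigma> = \<tau>]) blast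
  have "x \<notin> tree_game B T" if "follows_II \<tau>' x" for x
  proof (cases "x \<in> branches T")
    case True
    then obtain z where "retraction T z = x" "follows_II \<tau> z"
      using lift[of x] \<open>follows_II \<tau>' x\<close> unfolding follows_II_def by blast
    then show ?thesis
      using \<tau> True by (auto simp: tree_game_def)
  next
    case False
    then show ?thesis
      using legal[of x] first_move_leaving_tree[OF T(2) False] \<open>follows_II \<tau>' x\<close>
      unfolding follows_II_def tree_game_def by auto
  qed
  then show "(\<exists>\<sigma>. \<forall>x. follows_I \<sigma> x \<longrightarrow> x \<in> tree_game B T) \<or>
    (\<exists>\<tau>. \<forall>x. follows_II \<tau> x \<longrightarrow> x \<notin> tree_game B T)"
    by blast
qed

theorem theorem5p3:
  fixes \<Gamma> :: "('a topology \<times> 'a set) set"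
    and X :: "'a topology"
    and E :: "('a \<times> 'a) set"
  assumes "pointclass \<Gamma>"
    and "polish_topology X"
    and "equiv (topspace X) E"
    and "determinacy \<Gamma> X E"
  shows "\<forall>T. pruned_tree T \<longrightarrow> tree_determinacy \<Gamma> X E T"
proof (intro allI impI)
  fix T assume T: "pruned_tree T"
  show "tree_determinacy \<Gamma> X E T"
    unfolding tree_determinacy_def
  proof (intro allI impI, elim conjE)
    fix \<pi> A
    assume cont: "continuous_map (subtopology baire_space (branches T)) X \<pi>"
      and surj: "\<pi> ` branches T = topspace X"
      and A: "(X, A) \<in> \<Gamma>" "invariant_set E A"
    let ?B = "{x \<in> branches T. \<pi> x \<in> A}"
    show "determined (tree_game ?B T)"
    proof (cases "[] \<in> T")
      case False
      \<comment> \<open>A nonempty tree contains the root, but \<open>pruned_tree\<close> also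
        admits the empty set.\<close>
      then have "T = {}"
        using T by (auto simp: pruned_tree_def is_tree_def)
      then show ?thesis
        by (simp add: determined_tree_game_empty)
    next
      case True
      note branch = retraction_in_branches[OF T True]
      have "continuous_map baire_space X (\<pi> \<circ> retraction T)"
        by (rule continuous_map_compose[OF continuous_map_retraction[OF T True] cont])
      \<comment> \<open>Every branch is attained because the retraction fixes it.\<close>
      moreover have "range (retraction T) = branches T"
        using branch by (auto simp: image_iff intro: retraction_branch[symmetric])
      then have "(\<pi> \<circ> retraction T) ` topspace baire_space = topspace X"
        by (simp add: surj flip: image_image image_comp)
      ultimately have "determined {x \<in> topspace baire_space. (\<pi> \<circ> retraction T) x \<in> A}"
        using assms(4) A unfolding determinacy_def by blast
      then have "determined {x. retraction T x \<in> ?B}"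
        by (simp add: branch)
      then show ?thesis
        by (rule determined_tree_game[OF T True])
    qed
  qed
qed

end
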